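(* For every integer $n\ge0$ let $$P_n=P_n(q)=\sum_{i\ge0}\sum_{j\ge0}\sum_{k\ge0}q^{j(j+1)/2+i^2+k}\begin{bmatrix} j\\ i\end{bmatrix}_{q^2}\begin{bmatrix} j+k\\ k\end{bmatrix}_{q^2}\begin{bmatrix} n-2i-2k\\ j\end{bmatrix}_{q}.$$ Then $$P_n=\sum_{j=-\infty}^\infty(-1)^jq^{4j^2+j}\,V(n+1,4j+1;\sqrt q),$$ and $P_0=1$, $P_1=q+1$, $P_2=q^3+q^2+2q+1$, and $P_n=(1+q^n)P_{n-1}+qP_{n-2}+(q^{n-1}-q)P_{n-3}$ for $n\ge3$.
   Context: $q$ is an indeterminate with a formal square root $\sqrt q$. $(a;p)_n=\prod_{i=0}^{n-1}(1-ap^i)$. The Gaussian polynomial in base $p$ is $\begin{bmatrix} A\\ B\end{bmatrix}_{p}=\frac{(p;p)_A}{(p;p)_B(p;p)_{A-B}}$ if $0\le B\le A$, and $0$ otherwise. For integers $L\ge0$ and $A$, $$T_0(L,A;q)=\sum_{r=0}^L(-1)^r\begin{bmatrix} L\\ r\end{bmatrix}_{q^2}\begin{bmatrix} 2L-2r\\ L-A-r\end{bmatrix}_{q},\qquad T_1(L,A;q)=\sum_{r=0}^L(-q)^r\begin{bmatrix} L\\ r\end{bmatrix}_{q^2}\begin{bmatrix} 2L-2r\\ L-A-r\end{bmatrix}_{q},$$ and for $L\ge1$, $V(L,A;q)=T_1(L-1,A;q)+q^{L-A}\,T_0(L-1,A-1;q)$; $V(L,A;\sqrt q)$ is obtained by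 replacing $q$ by $\sqrt q$. All sums have only finitely many nonzero terms. *)

theory Defs
  imports
    "HOL-Library.Groups_Big_Fun"
    "HOL-Computational_Algebra.Polynomial"
    "HOL-Computational_Algebra.Fraction_Field"
begin

(* Everything is defined over an arbitrary field, with the base as an explicit
   argument, so that replacing q by its square root or by q^2 is just a change of
   argument.  The identities are stated in the field of fractions of Z[s], with
   s the formal square root of the indeterminate q. *)

definition sqrt_q :: "int poly fract" where
  "sqrt_q = Fract [:0, 1:] 1"

definition q_indet :: "int poly fract" where
  "q_indet = sqrt_q ^ 2"

definition qpoch :: "'a::field \<Rightarrow> 'a \<Rightarrow> nat \<Rightarrow> 'a" where
  "qpoch a p n = (\<Prod>i<n. 1 - a * p ^ i)"

definition gauss_binom :: "'a::field \<Rightarrow> int \<Rightarrow> int \<Rightarrow> 'a" where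
  "gauss_binom p A B =
     (if 0 \<le> B \<and> B \<le> A
      then qpoch p p (nat A) / (qpoch p p (nat B) * qpoch p p (nat (A - B)))
      else 0)"

definition T0 :: "nat \<Rightarrow> int \<Rightarrow> 'a::field \<Rightarrow> 'a" where
  "T0 L A q =
     (\<Sum>r=0..L. (- 1) ^ r * gauss_binom (q ^ 2) (int L) (int r)
                 * gauss_binom q (2 * int L - 2 * int r) (int L - A - int r))"

definition T1 :: "nat \<Rightarrow> int \<Rightarrow> 'a::field \<Rightarrow> 'a" where
  "T1 L A q =
     (\<Sum>r=0..L. (- q) ^ r * gauss_binom (q ^ 2) (int L) (int r)
                 * gauss_binom q (2 * int L - 2 * int r) (int L - A - int r))"

(* Only meaningful for L \<ge> 1, because of the truncated subtraction L - 1. *)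
definition V :: "nat \<Rightarrow> int \<Rightarrow> 'a::field \<Rightarrow> 'a" where
  "V L A q = T1 (L - 1) A q + q powi (int L - A) * T0 (L - 1) (A - 1) q"

definition P_term :: "nat \<Rightarrow> 'a::field \<Rightarrow> nat \<Rightarrow> nat \<Rightarrow> nat \<Rightarrow> 'a" where
  "P_term n q i j k =
     q ^ (j * (j + 1) div 2 + i ^ 2 + k)
       * gauss_binom (q ^ 2) (int j) (int i)
       * gauss_binom (q ^ 2) (int j + int k) (int k)
       * gauss_binom q (int n - 2 * int i - 2 * int k) (int j)"

(* Sum_any sums a finitely supported family (and is 0 on any other family); the
   lemmas below show that all the families summed here are finitely supported. *)
definition P :: "nat \<Rightarrow> 'a::field \<Rightarrow> 'a" where
  "P n q = Sum_any (\<lambda>i. Sum_any (\<lambda>j. Sum_any (\<lambda>k. P_term n q i j k)))"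

lemma P_term_nonzeroD:
  assumes "P_term n q i j k \<noteq> 0"
  shows "i \<le> n \<and> j \<le> n \<and> k \<le> n"
proof -
  have "gauss_binom q (int n - 2 * int i - 2 * int k) (int j) \<noteq> 0"
    using assms by (auto simp: P_term_def)
  then have "int j \<le> int n - 2 * int i - 2 * int k"
    by (auto simp: gauss_binom_def split: if_splits)
  then show ?thesis by linarith
qed

lemma finite_support_P_k: "finite {k. P_term n q i j k \<noteq> 0}"
  by (rule finite_subset[of _ "{..n}"]) (auto dest: P_term_nonzeroD)

lemma finite_support_P_j: "finite {j. Sum_any (\<lambda>k. P_term n q i j k) \<noteq> 0}"
proof (rule finite_subset[of _ "{..n}"])
  show "{j. Sum_any (\<lambda>k. P_term n q i j k) \<noteq> 0} \<subseteq> {..n}"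
  proof
    fix j assume "j \<in> {j. Sum_any (\<lambda>k. P_term n q i j k) \<noteq> 0}"
    then obtain k where "P_term n q i j k \<noteq> 0"
      using Sum_any.not_neutral_obtains_not_neutral by blast
    then show "j \<in> {..n}" by (auto dest: P_term_nonzeroD)
  qed
qed simp

lemma finite_support_P_i:
  "finite {i. Sum_any (\<lambda>j. Sum_any (\<lambda>k. P_term n q i j k)) \<noteq> 0}"
proof (rule finite_subset[of _ "{..n}"])
  show "{i. Sum_any (\<lambda>j. Sum_any (\<lambda>k. P_term n q i j k)) \<noteq> 0} \<subseteq> {..n}"
  proof
    fix i assume "i \<in> {i. Sum_any (\<lambda>j. Sum_any (\<lambda>k. P_term n q i j k)) \<noteq> 0}"
    then obtain j where "Sum_any (\<lambda>k. P_term n q i j k) \<noteq> 0"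
      using Sum_any.not_neutral_obtains_not_neutral by blast
    then obtain k where "P_term n q i j k \<noteq> 0"
      using Sum_any.not_neutral_obtains_not_neutral by blast
    then show "i \<in> {..n}" by (auto dest: P_term_nonzeroD)
  qed
qed simp

lemma T0_eq_0: "\<bar>A\<bar> > int L \<Longrightarrow> T0 L A q = 0"
  unfolding T0_def by (rule sum.neutral) (auto simp: gauss_binom_def)

lemma T1_eq_0: "\<bar>A\<bar> > int L \<Longrightarrow> T1 L A q = 0"
  unfolding T1_def by (rule sum.neutral) (auto simp: gauss_binom_def)

lemma finite_support_V:
  "finite {j :: int. c j * V (n + 1) (4 * j + 1) q \<noteq> 0}"
proof (rule finite_subset[of _ "{- int n - 1 .. int n + 1}"])
  show "{j. c j * V (n + 1) (4 * j + 1) q \<noteq> 0} \<subseteq> {- int n - 1 .. int n + 1}"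
  proof
    fix j assume "j \<in> {j. c j * V (n + 1) (4 * j + 1) q \<noteq> 0}"
    then have "T1 n (4 * j + 1) q \<noteq> 0 \<or> T0 n (4 * j) q \<noteq> 0"
      by (auto simp: V_def)
    then have "\<bar>4 * j + 1\<bar> \<le> int n \<or> \<bar>4 * j\<bar> \<le> int n"
      using T0_eq_0[of n "4 * j" q] T1_eq_0[of n "4 * j + 1" q] by linarith
    then show "j \<in> {- int n - 1 .. int n + 1}" by auto
  qed
qed simp

end

theory Submission
  imports Defs "HOL-Computational_Algebra.Formal_Power_Series"
begin

text \<open>
  Both sides of the identity satisfy the same linear recurrence of order three and agree for
  \<open>n = 0, 1, 2\<close>.  Throughout, \<open>p\<close> stands for the square root of \<open>q\<close>.

  The triple sum: the generating function of \<open>P n q\<close> is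
  \<open>G(X) = \<Sum>j. q^(j(j+1)/2) X^j (-qX\<^sup>2;q\<^sup>2)_j / ((X;q)_(j+1) (qX\<^sup>2;q\<^sup>2)_(j+1))\<close>,
  by the \<open>q\<close>-binomial theorem, applied to one finite product and to two reciprocal products.  Consecutive terms are related by the
  dilation \<open>X \<mapsto> qX\<close>, which yields
  \<open>(1 - X)(1 - qX\<^sup>2) G(X) = 1 + qX(1 + qX\<^sup>2) G(qX)\<close> (\<open>P_fps_equation\<close>).  Comparing coefficients gives
  the recurrence and the initial values (\<open>P_recurrence\<close>).

  The bilateral sum: write \<open>V_L(A)\<close> for \<open>V (L + 1) A p\<close>.  Combining the recurrences of the
  \<open>q\<close>-trinomial coefficients \<open>T0\<close> and \<open>T1\<close> gives the symmetry \<open>V_L(1 - A) = V_L(A)\<close> and the system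
  (\<open>T0_Suc_V\<close>, \<open>V_Suc\<close>)
  \<open>T0(L+1, A) = T0(L, A-1) + p^(L+1+A) V_L(A+1)\<close>,
  \<open>V_(L+1)(A) = (1 + p^(2L+2)) V_L(A) + p^(L+1+A) T0(L, A+1) + p^(L+2-A) T0(L, A-2)\<close>.
  Let \<open>\<theta>_a(f) = \<Sum>j. (-1)^j p^(A(A-1)/2) f(A)\<close> with \<open>A = 4j + a\<close>.  The exponent makes a factor
  \<open>p^A\<close> equivalent to a shift of \<open>a\<close>, and \<open>\<theta>\<close> changes sign when \<open>a\<close> increases by 4.  With
  \<open>R = \<theta>_1(V_L)\<close>, \<open>G = \<theta>_1(T0) + \<theta>_2(T0)\<close> and \<open>H = \<theta>_0(T0) + \<theta>_(-1)(T0)\<close>, the system collapses to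
  \<open>R' = (1 + q^(L+1)) R + p^(L+1) G\<close>, \<open>G' = H\<close>, \<open>H' = G + 2 p^(L+1) R\<close>,
  where primes denote the step from \<open>L\<close> to \<open>L + 1\<close>.  Eliminating \<open>G\<close> and \<open>H\<close> leaves the
  recurrence of \<open>P n q\<close> (\<open>theta_V_recurrence\<close>).
\<close>

section \<open>Gaussian polynomials\<close>

text \<open>
  The base must be nonzero because integer powers of it occur, and no positive power of it may be
  1, since otherwise the quotients defining Gaussian polynomials degenerate to division by zero.
\<close>

definition generic :: "'a::field \<Rightarrow> bool" where
  "generic p \<longleftrightarrow> p \<noteq> 0 \<and> (\<forall>n>0. p ^ n \<noteq> 1)"

lemma generic_nonzero: "generic p \<Longrightarrow> p \<noteq> 0"
  by (simp add: generic_def)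

lemma generic_power2: "generic p \<Longrightarrow> generic (p ^ 2)"
  by (simp add: generic_def flip: power_mult)

lemma qpoch_Suc: "qpoch p p (Suc n) = qpoch p p n * (1 - p ^ Suc n)"
  by (simp add: qpoch_def)

lemma qpoch_0 [simp]: "qpoch a p 0 = 1"
  by (simp add: qpoch_def)

lemma qpoch_nonzero: "generic p \<Longrightarrow> qpoch p p n \<noteq> 0"
  by (induction n) (auto simp: qpoch_Suc generic_def simp del: power_Suc)

lemma gauss_binom_eq_0: "B < 0 \<or> A < B \<Longrightarrow> gauss_binom p A B = 0"
  by (auto simp: gauss_binom_def)

lemma gauss_binom_0_right [simp]: "generic p \<Longrightarrow> 0 \<le> A \<Longrightarrow> gauss_binom p A 0 = 1"
  using qpoch_nonzero by (auto simp: gauss_binom_def)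

lemma gauss_binom_self: "generic p \<Longrightarrow> 0 \<le> A \<Longrightarrow> gauss_binom p A A = 1"
  using qpoch_nonzero by (auto simp: gauss_binom_def)

lemma gauss_binom_symmetric: "gauss_binom p A (A - B) = gauss_binom p A B"
  by (auto simp: gauss_binom_def mult.commute)

lemma gauss_binom_of_nat:
  "gauss_binom p (int (b + c)) (int b) = qpoch p p (b + c) / (qpoch p p b * qpoch p p c)"
  by (simp add: gauss_binom_def nat_int_add)

lemma gauss_binom_absorb:
  assumes "generic p"
  shows "(1 - p powi B) * gauss_binom p A B = (1 - p powi A) * gauss_binom p (A - 1) (B - 1)"
proof (cases "1 \<le> B \<and> B \<le> A")
  case True
  define b where "b = nat (B - 1)"
  define c where "c = nat (A - B)"
  have B: "B = int (Suc b)" and A: "A = int (Suc b + c)"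
    using True by (auto simp: b_def c_def)
  have nz: "qpoch p p n \<noteq> 0" for n
    using assms by (rule qpoch_nonzero)
  have nz': "1 - p ^ Suc n \<noteq> 0" for n
    using assms by (auto simp: generic_def simp del: power_Suc)
  have 1: "gauss_binom p A B
      = qpoch p p (b + c) * (1 - p ^ Suc (b + c)) / (qpoch p p b * (1 - p ^ Suc b) * qpoch p p c)"
    unfolding A B gauss_binom_of_nat by (simp only: add_Suc qpoch_Suc)
  have "A - 1 = int (b + c)" "B - 1 = int b"
    unfolding A B by simp_all
  then have 2: "gauss_binom p (A - 1) (B - 1) = qpoch p p (b + c) / (qpoch p p b * qpoch p p c)"
    by (simp only: gauss_binom_of_nat)
  have 3: "p powi B = p ^ Suc b" "p powi A = p ^ Suc (b + c)"
    unfolding A B by (simp_all only: power_int_of_nat add_Suc)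
  show ?thesis
    unfolding 1 2 3 using nz nz'[of b] by (simp add: field_simps del: power_Suc)
next
  case False
  then consider "B < 0" | "B = 0" | "B > A" by linarith
  then show ?thesis
  proof cases
    case 3
    then show ?thesis by (cases "A = 0") (auto simp: gauss_binom_eq_0)
  qed (auto simp: gauss_binom_eq_0)
qed

text \<open>
  The bound on the upper index is essential: for \<open>A = -1\<close>, \<open>B = 0\<close> the left-hand side is 1 and the
  right-hand side is 0.
\<close>

lemma gauss_binom_Pascal1:
  assumes "generic p" "0 \<le> A"
  shows "gauss_binom p (A + 1) B = gauss_binom p A (B - 1) + p powi B * gauss_binom p A B"
proof (cases "0 < B \<and> B \<le> A")
  case True
  define b where "b = nat (B - 1)"
  define c where "c = nat (A - B)"
  have B: "B = int (Suc b)" and A: "A = int (Suc b + c)"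
    using True by (auto simp: b_def c_def)
  have nz: "qpoch p p n \<noteq> 0" for n
    using assms(1) by (rule qpoch_nonzero)
  have nz': "1 - p ^ Suc n \<noteq> 0" for n
    using assms(1) by (auto simp: generic_def simp del: power_Suc)
  have "A + 1 = int (Suc b + Suc c)" "B - 1 = int b" "A = int (b + Suc c)"
    unfolding A B by simp_all
  then have 1: "gauss_binom p (A + 1) B
      = qpoch p p (Suc b + Suc c) / (qpoch p p (Suc b) * qpoch p p (Suc c))"
    and 2: "gauss_binom p A (B - 1) = qpoch p p (b + Suc c) / (qpoch p p b * qpoch p p (Suc c))"
    by (simp_all only: B gauss_binom_of_nat)
  have 3: "gauss_binom p A B = qpoch p p (Suc b + c) / (qpoch p p (Suc b) * qpoch p p c)"
    by (simp only: A B gauss_binom_of_nat)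
  have 4: "p powi B = p ^ Suc b"
    unfolding B by (simp only: power_int_of_nat)
  have 5: "p ^ Suc (Suc (b + c)) = p ^ Suc b * p ^ Suc c"
    by (simp add: power_add)
  have gen: "x * (1 - u * v) / (y * (1 - u) * (z * (1 - v)))
      = x / (y * (z * (1 - v))) + u * (x / (y * (1 - u) * z))"
    if "y \<noteq> 0" "z \<noteq> 0" "1 - u \<noteq> 0" "1 - v \<noteq> 0" for x y z u v :: 'a
    using that by (simp add: divide_simps) (simp add: algebra_simps)
  show ?thesis
    unfolding 1 2 3 4 using gen[OF nz nz nz' nz'] by (simp only: add_Suc add_Suc_right qpoch_Suc 5)
next
  case False
  then consider "B < 0" | "B = 0" | "B = A + 1" | "B > A + 1" by linarith
  then show ?thesis
    using assms by cases (auto simp: gauss_binom_eq_0 gauss_binom_self)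
qed

lemma gauss_binom_Pascal2:
  assumes "generic p" "0 \<le> A"
  shows "gauss_binom p (A + 1) B = gauss_binom p A B + p powi (A + 1 - B) * gauss_binom p A (B - 1)"
proof -
  have "gauss_binom p (A + 1) B = gauss_binom p (A + 1) (A + 1 - B)"
    by (simp add: gauss_binom_symmetric)
  also have "\<dots> = gauss_binom p A (A - B) + p powi (A + 1 - B) * gauss_binom p A (A - (B - 1))"
    using gauss_binom_Pascal1[OF assms, of "A + 1 - B"] by (simp add: algebra_simps)
  finally show ?thesis by (simp only: gauss_binom_symmetric)
qed

section \<open>Recurrences for the q-trinomial coefficients\<close>

text \<open>
  Reversing the sums that define \<open>T0\<close> and \<open>T1\<close> (\<open>s = L - r\<close>) makes the Gaussian polynomial
  \<open>[2s; s - A]\<close> independent of \<open>L\<close>.  All the \<open>L\<close>-dependence is then in one linear functional, and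
  recurrences in \<open>L\<close> become properties of this functional.
\<close>

definition alt_sum :: "'a::field \<Rightarrow> nat \<Rightarrow> (nat \<Rightarrow> 'a) \<Rightarrow> 'a" where
  "alt_sum p L f = (\<Sum>s\<le>L. (- 1) ^ (L - s) * gauss_binom (p ^ 2) (int L) (int s) * f s)"

lemma alt_sum_add: "alt_sum p L (\<lambda>s. f s + g s) = alt_sum p L f + alt_sum p L g"
  by (simp add: alt_sum_def algebra_simps sum.distrib)

lemma alt_sum_diff: "alt_sum p L (\<lambda>s. f s - g s) = alt_sum p L f - alt_sum p L g"
  by (simp add: alt_sum_def algebra_simps sum_subtractf)

lemma alt_sum_scale: "alt_sum p L (\<lambda>s. c * f s) = c * alt_sum p L f"
  by (simp add: alt_sum_def algebra_simps sum_distrib_left)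

lemma alt_sum_cong: "(\<And>s. s \<le> L \<Longrightarrow> f s = g s) \<Longrightarrow> alt_sum p L f = alt_sum p L g"
  by (simp add: alt_sum_def)

lemma T0_alt_sum: "T0 L A p = alt_sum p L (\<lambda>s. gauss_binom p (2 * int s) (int s - A))"
  unfolding T0_def alt_sum_def
  by (rule sum.reindex_bij_witness[of _ "\<lambda>s. L - s" "\<lambda>r. L - r"])
     (auto simp: of_nat_diff gauss_binom_symmetric algebra_simps)

lemma T1_alt_sum:
  "T1 L A p = alt_sum p L (\<lambda>s. p ^ (L - s) * gauss_binom p (2 * int s) (int s - A))"
  unfolding T1_def alt_sum_def
  by (rule sum.reindex_bij_witness[of _ "\<lambda>s. L - s" "\<lambda>r. L - r"])
     (auto simp: of_nat_diff gauss_binom_symmetric algebra_simps power_minus[of p])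

lemma gauss_binom_central_symmetric:
  "gauss_binom p (2 * int s) (int s - A) = gauss_binom p (2 * int s) (int s + A)"
  using gauss_binom_symmetric[of p "2 * int s" "int s + A"] by simp

lemma T0_minus: "T0 L (- A) p = T0 L A p"
  unfolding T0_alt_sum by (simp add: gauss_binom_central_symmetric)

lemma T1_minus: "T1 L (- A) p = T1 L A p"
  unfolding T1_alt_sum by (simp add: gauss_binom_central_symmetric)

text \<open>
  Summation skeleton for both forms of Pascal's rule: a weight at level \<open>Suc L\<close> splits into a shifted
  and an unshifted weight at level \<open>L\<close>.
\<close>

lemma sum_Suc_split:
  fixes g h :: "nat \<Rightarrow> 'a::comm_monoid_add"
  assumes "\<And>s. s \<le> Suc L \<Longrightarrow> F s = (if s = 0 then 0 else g (s - 1)) + (if s = Suc L then 0 else h s)"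
  shows "(\<Sum>s\<le>Suc L. F s) = (\<Sum>s\<le>L. g s + h s)"
proof -
  have "(\<Sum>s\<le>Suc L. F s)
      = (\<Sum>s\<le>Suc L. (if s = 0 then 0 else g (s - 1)) + (if s = Suc L then 0 else h s))"
    using assms by (intro sum.cong) auto
  also have "\<dots> = (\<Sum>s\<le>Suc L. if s = 0 then 0 else g (s - 1)) + (\<Sum>s\<le>Suc L. if s = Suc L then 0 else h s)"
    by (rule sum.distrib)
  also have "(\<Sum>s\<le>Suc L. if s = 0 then 0 else g (s - 1)) = (\<Sum>s\<le>L. g s)"
    by (subst sum.atMost_Suc_shift) simp
  also have "(\<Sum>s\<le>Suc L. if s = Suc L then 0 else h s) = (\<Sum>s\<le>L. h s)"
    by simp
  finally show ?thesis by (simp add: sum.distrib)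
qed

lemma alt_sum_Suc:
  assumes "generic p"
  shows "alt_sum p (Suc L) f = alt_sum p L (\<lambda>s. f (Suc s) - p ^ (2 * s) * f s)"
proof -
  let ?b = "gauss_binom (p ^ 2)"
  have "alt_sum p (Suc L) f = (\<Sum>s\<le>L. (- 1) ^ (L - s) * ?b (int L) (int s) * f (Suc s)
      + (- 1) ^ (Suc L - s) * p ^ (2 * s) * ?b (int L) (int s) * f s)"
    unfolding alt_sum_def
  proof (rule sum_Suc_split)
    fix s assume "s \<le> Suc L"
    have "?b (int (Suc L)) (int s) = ?b (int L) (int s - 1) + p ^ (2 * s) * ?b (int L) (int s)"
      using gauss_binom_Pascal1[OF generic_power2[OF assms], of "int L" "int s"]
      by (simp add: add.commute flip: power_mult)
    then show "(- 1) ^ (Suc L - s) * ?b (int (Suc L)) (int s) * f s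
      = (if s = 0 then 0 else (- 1) ^ (L - (s - 1)) * ?b (int L) (int (s - 1)) * f (Suc (s - 1)))
      + (if s = Suc L then 0 else (- 1) ^ (Suc L - s) * p ^ (2 * s) * ?b (int L) (int s) * f s)"
      by (cases s) (auto simp: gauss_binom_eq_0 algebra_simps)
  qed
  also have "\<dots> = alt_sum p L (\<lambda>s. f (Suc s) - p ^ (2 * s) * f s)"
    unfolding alt_sum_def by (intro sum.cong) (auto simp: Suc_diff_le algebra_simps)
  finally show ?thesis .
qed

lemma alt_sum_Suc':
  assumes "generic p"
  shows "alt_sum p (Suc L) f = alt_sum p L (\<lambda>s. p ^ (2 * (L - s)) * f (Suc s) - f s)"
proof -
  let ?b = "gauss_binom (p ^ 2)"
  have "alt_sum p (Suc L) f = (\<Sum>s\<le>L. (- 1) ^ (L - s) * p ^ (2 * (L - s)) * ?b (int L) (int s) * f (Suc s)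
      + (- 1) ^ (Suc L - s) * ?b (int L) (int s) * f s)"
    unfolding alt_sum_def
  proof (rule sum_Suc_split)
    fix s assume s: "s \<le> Suc L"
    have "int L + 1 - int s = int (Suc L - s)"
      using s by simp
    then have "(p ^ 2) powi (int L + 1 - int s) = p ^ (2 * (Suc L - s))"
      by (simp only: power_int_of_nat power_mult)
    then have "?b (int (Suc L)) (int s)
        = ?b (int L) (int s) + p ^ (2 * (Suc L - s)) * ?b (int L) (int s - 1)"
      using gauss_binom_Pascal2[OF generic_power2[OF assms], of "int L" "int s"]
      by (simp add: add.commute)
    then show "(- 1) ^ (Suc L - s) * ?b (int (Suc L)) (int s) * f s
      = (if s = 0 then 0 else
          (- 1) ^ (L - (s - 1)) * p ^ (2 * (L - (s - 1))) * ?b (int L) (int (s - 1)) * f (Suc (s - 1)))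
      + (if s = Suc L then 0 else (- 1) ^ (Suc L - s) * ?b (int L) (int s) * f s)"
      by (cases s) (auto simp: gauss_binom_eq_0 algebra_simps)
  qed
  also have "\<dots> = alt_sum p L (\<lambda>s. p ^ (2 * (L - s)) * f (Suc s) - f s)"
    unfolding alt_sum_def by (intro sum.cong) (auto simp: Suc_diff_le algebra_simps)
  finally show ?thesis .
qed

text \<open>
  The two forms of Pascal's rule for the same functional must agree; their difference is a
  summation-by-parts identity.
\<close>

lemma alt_sum_absorb:
  assumes "generic p"
  shows "alt_sum p L (\<lambda>s. (1 - p ^ (2 * (L - s))) * f (Suc s)) = - alt_sum p L (\<lambda>s. (1 - p ^ (2 * s)) * f s)"
proof -
  have "alt_sum p L (\<lambda>s. (f (Suc s) - p ^ (2 * s) * f s) - (p ^ (2 * (L - s)) * f (Suc s) - f s))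
      = alt_sum p (Suc L) f - alt_sum p (Suc L) f"
    unfolding alt_sum_diff[of _ _ "\<lambda>s. f (Suc s) - p ^ (2 * s) * f s"]
    by (simp only: alt_sum_Suc[OF assms, of L f, symmetric] alt_sum_Suc'[OF assms, of L f, symmetric])
  then have "alt_sum p L (\<lambda>s. (f (Suc s) - p ^ (2 * s) * f s) - (p ^ (2 * (L - s)) * f (Suc s) - f s)) = 0"
    by simp
  then have "alt_sum p L (\<lambda>s. (1 - p ^ (2 * (L - s))) * f (Suc s) + (1 - p ^ (2 * s)) * f s) = 0"
    by (simp add: algebra_simps)
  then show ?thesis
    by (simp only: alt_sum_add eq_neg_iff_add_eq_0)
qed

text \<open>
  Here Pascal's rule for the functional suffices: after it, the identity holds summand by summand,
  because \<open>[2s + 2; s + 1 - A]\<close> is a combination of \<open>[2s; s - A]\<close> and its two neighbours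
  \<open>[2s; s - A - 1]\<close> and \<open>[2s; s - A + 1]\<close>.
\<close>

lemma T1_Suc:
  assumes "generic p"
  shows "T1 (Suc L) A p = T1 L A p + p powi (int L + 1 + A) * T0 L (A + 1) p
           + p powi (int L + 1 - A) * T0 L (A - 1) p"
proof -
  let ?b = "\<lambda>s. gauss_binom p (2 * int s)"
  have p: "p \<noteq> 0" using assms by (rule generic_nonzero)
  have step: "p ^ (Suc L - Suc s) * ?b (Suc s) (int (Suc s) - A)
        - p ^ (2 * s) * (p ^ (Suc L - s) * ?b s (int s - A))
      = p ^ (L - s) * ?b s (int s - A) + p powi (int L + 1 + A) * ?b s (int s - (A + 1))
        + p powi (int L + 1 - A) * ?b s (int s - (A - 1))" if "s \<le> L" for s
  proof -
    obtain r where r: "L = s + r" using \<open>s \<le> L\<close> le_Suc_ex by blast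
    have "?b (Suc s) (int (Suc s) - A) = gauss_binom p (2 * int s + 1) (int s - A)
        + p powi (int s + 1 - A) * gauss_binom p (2 * int s + 1) (int s + 1 - A)"
      using gauss_binom_Pascal1[OF assms, of "2 * int s + 1" "int s + 1 - A"]
      by (simp add: algebra_simps)
    also have "gauss_binom p (2 * int s + 1) (int s - A)
        = ?b s (int s - A) + p powi (int s + 1 + A) * ?b s (int s - (A + 1))"
      using gauss_binom_Pascal2[OF assms, of "2 * int s" "int s - A"]
      by (simp add: algebra_simps)
    also have "gauss_binom p (2 * int s + 1) (int s + 1 - A)
        = ?b s (int s - (A - 1)) + p powi (int s + A) * ?b s (int s - A)"
      using gauss_binom_Pascal2[OF assms, of "2 * int s" "int s + 1 - A"]
      by (simp add: algebra_simps)
    finally have *: "?b (Suc s) (int (Suc s) - A) =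
        ?b s (int s - A) + p powi (int s + 1 + A) * ?b s (int s - (A + 1)) +
        p powi (int s + 1 - A) * (?b s (int s - (A - 1)) + p powi (int s + A) * ?b s (int s - A))" .
    show ?thesis
      unfolding * unfolding r using p
      by (simp add: power_int_add power_int_diff power_add power_mult power2_eq_square field_simps)
  qed
  show ?thesis
    unfolding T1_alt_sum[of "Suc L"] alt_sum_Suc[OF assms]
    unfolding T0_alt_sum T1_alt_sum
    by (simp only: step alt_sum_add alt_sum_scale cong: alt_sum_cong)
qed

text \<open>
  In contrast to \<open>T1\<close>, the summands do not match: they differ by two terms that involve the odd row
  \<open>[2s - 1; s - A]\<close> and cancel only after summation by parts.
\<close>

lemma T0_Suc:
  assumes "generic p"
  shows "T0 (Suc L) A p = T0 L (A - 1) p + p powi (int L + 1 + A) * T1 L A p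
           + p powi (2 * (int L + 1 + A)) * T0 L (A + 1) p"
proof -
  let ?b = "\<lambda>s. gauss_binom p (2 * int s)"
  let ?c = "\<lambda>s. gauss_binom p (2 * int s - 1) (int s - A)"
  have p: "p \<noteq> 0" using assms by (rule generic_nonzero)
  have step: "p ^ (2 * (L - s)) * ?b (Suc s) (int (Suc s) - A) - ?b s (int s - A)
      = ?b s (int s - (A - 1)) + p powi (int L + 1 + A) * (p ^ (L - s) * ?b s (int s - A))
        + p powi (2 * (int L + 1 + A)) * ?b s (int s - (A + 1))
        - ((1 - p ^ (2 * (L - s))) * ?c (Suc s) + (1 - p ^ (2 * s)) * ?c s)" if "s \<le> L" for s
  proof -
    obtain r where r: "L = s + r" using \<open>s \<le> L\<close> le_Suc_ex by blast
    have "?b (Suc s) (int (Suc s) - A) = gauss_binom p (2 * int s + 1) (int s + 1 - A)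
        + p powi (int s + 1 + A) * gauss_binom p (2 * int s + 1) (int s - A)"
      using gauss_binom_Pascal2[OF assms, of "2 * int s + 1" "int s + 1 - A"]
      by (simp add: algebra_simps)
    also have "gauss_binom p (2 * int s + 1) (int s - A)
        = ?b s (int s - A) + p powi (int s + 1 + A) * ?b s (int s - (A + 1))"
      using gauss_binom_Pascal2[OF assms, of "2 * int s" "int s - A"]
      by (simp add: algebra_simps)
    also have O: "gauss_binom p (2 * int s + 1) (int s + 1 - A)
        = ?b s (int s - (A - 1)) + p powi (int s + A) * ?b s (int s - A)"
      using gauss_binom_Pascal2[OF assms, of "2 * int s" "int s + 1 - A"]
      by (simp add: algebra_simps)
    finally have 1: "?b (Suc s) (int (Suc s) - A) =
        ?b s (int s - (A - 1)) + p powi (int s + A) * ?b s (int s - A) +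
        p powi (int s + 1 + A) * (?b s (int s - A) + p powi (int s + 1 + A) * ?b s (int s - (A + 1)))" .
    have 2: "?c (Suc s) = ?b s (int s - (A - 1)) + p powi (int s + A) * ?b s (int s - A)"
      unfolding O[symmetric] by (simp add: algebra_simps)
    have 3: "(1 - p ^ (2 * s)) * ?c s = (1 - p powi (int s + A)) * ?b s (int s - A)"
    proof -
      have "(1 - p powi (int s + A)) * ?b s (int s + A)
          = (1 - p powi (2 * int s)) * gauss_binom p (2 * int s - 1) (int s + A - 1)"
        by (rule gauss_binom_absorb[OF assms])
      moreover have "p powi (2 * int s) = p ^ (2 * s)"
        using power_int_of_nat[of p "2 * s"] by simp
      moreover have "gauss_binom p (2 * int s - 1) (int s + A - 1) = ?c s"
        using gauss_binom_symmetric[of p "2 * int s - 1" "int s - A"] by (simp add: algebra_simps)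
      ultimately show ?thesis by (simp add: gauss_binom_central_symmetric)
    qed
    show ?thesis
      unfolding 1 2 3 unfolding r using p
      by (simp add: power_int_add power_int_diff power_add power_mult power2_eq_square
            power_int_mult field_simps)
  qed
  \<comment> \<open>the mismatch sums to zero although it is not zero termwise\<close>
  have vanish: "alt_sum p L (\<lambda>s. (1 - p ^ (2 * (L - s))) * ?c (Suc s) + (1 - p ^ (2 * s)) * ?c s) = 0"
    by (simp only: alt_sum_add alt_sum_absorb[OF assms, where f = ?c]) simp
  have "T0 (Suc L) A p = alt_sum p L (\<lambda>s. p ^ (2 * (L - s)) * ?b (Suc s) (int (Suc s) - A) - ?b s (int s - A))"
    unfolding T0_alt_sum by (rule alt_sum_Suc'[OF assms])
  also have "\<dots> = alt_sum p L (\<lambda>s. ?b s (int s - (A - 1))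
        + p powi (int L + 1 + A) * (p ^ (L - s) * ?b s (int s - A))
        + p powi (2 * (int L + 1 + A)) * ?b s (int s - (A + 1))
        - ((1 - p ^ (2 * (L - s))) * ?c (Suc s) + (1 - p ^ (2 * s)) * ?c s))"
    by (rule alt_sum_cong) (rule step)
  also have "\<dots> = alt_sum p L (\<lambda>s. ?b s (int s - (A - 1)))
        + p powi (int L + 1 + A) * alt_sum p L (\<lambda>s. p ^ (L - s) * ?b s (int s - A))
        + p powi (2 * (int L + 1 + A)) * alt_sum p L (\<lambda>s. ?b s (int s - (A + 1)))"
    unfolding alt_sum_diff vanish by (simp only: alt_sum_add alt_sum_scale diff_zero)
  finally show ?thesis unfolding T0_alt_sum T1_alt_sum .
qed

text \<open>
  Up to the common weight \<open>p^(L - s)\<close>, the functional is applied on each side to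
  \<open>(1 - p^(2s)) [2s - 1; s - A - 1]\<close>: on the left directly by absorption, on the right by absorption after reflecting the
  row.
\<close>

lemma T1_T0_relation:
  assumes "generic p"
  shows "T1 L A p - p powi (int L - A) * T0 L A p
           = T1 L (A + 1) p - p powi (int L + A + 1) * T0 L (A + 1) p"
proof -
  let ?b = "\<lambda>s. gauss_binom p (2 * int s)"
  have p: "p \<noteq> 0" using assms by (rule generic_nonzero)
  have 1: "p ^ (L - s) * ?b s (int s - A) - p powi (int L - A) * ?b s (int s - A)
      = p ^ (L - s) * ?b s (int s - (A + 1)) - p powi (int L + A + 1) * ?b s (int s - (A + 1))"
    if "s \<le> L" for s
  proof -
    obtain r where r: "L = s + r" using \<open>s \<le> L\<close> le_Suc_ex by blast
    have "(1 - p powi (int s - A)) * ?b s (int s - A)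
        = (1 - p powi (2 * int s)) * gauss_binom p (2 * int s - 1) (int s - A - 1)"
      by (rule gauss_binom_absorb[OF assms])
    also have "gauss_binom p (2 * int s - 1) (int s - A - 1) = gauss_binom p (2 * int s - 1) (int s + A)"
      using gauss_binom_symmetric[of p "2 * int s - 1" "int s + A"] by (simp add: algebra_simps)
    also have "(1 - p powi (2 * int s)) * \<dots> = (1 - p powi (int s + (A + 1))) * ?b s (int s + (A + 1))"
      using gauss_binom_absorb[OF assms, of "int s + (A + 1)" "2 * int s"] by (simp add: algebra_simps)
    finally have "p ^ r * ((1 - p powi (int s - A)) * ?b s (int s - A))
        = p ^ r * ((1 - p powi (int s + (A + 1))) * ?b s (int s - (A + 1)))"
      by (simp only: gauss_binom_central_symmetric[of p s "A + 1"])
    then show ?thesis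
      unfolding r using p by (simp add: power_int_add power_int_diff power_add field_simps)
  qed
  have "alt_sum p L (\<lambda>s. p ^ (L - s) * ?b s (int s - A) - p powi (int L - A) * ?b s (int s - A))
      = alt_sum p L (\<lambda>s. p ^ (L - s) * ?b s (int s - (A + 1))
          - p powi (int L + A + 1) * ?b s (int s - (A + 1)))"
    by (rule alt_sum_cong) (rule 1)
  then show ?thesis
    unfolding T0_alt_sum T1_alt_sum by (simp only: alt_sum_diff alt_sum_scale)
qed

text \<open>
  The second representation of \<open>V\<close> exhibits its symmetry under \<open>A \<mapsto> 1 - A\<close>, and it lets \<open>V\<close> absorb two
  of the three terms in the recurrence for \<open>T0\<close>.
\<close>

lemma V_eq_shifted:
  assumes "generic p"
  shows "V (Suc L) A p = T1 L (A - 1) p + p powi (int L + A) * T0 L A p"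
  using T1_T0_relation[OF assms, of L "A - 1"] by (simp add: V_def algebra_simps)

lemma V_reflect:
  assumes "generic p"
  shows "V (Suc L) (1 - A) p = V (Suc L) A p"
  using T1_minus[of L "A - 1" p] T0_minus[of L A p]
  by (subst V_eq_shifted[OF assms]) (simp add: V_def V_eq_shifted[OF assms, of L A])

lemma T0_Suc_V:
  assumes "generic p"
  shows "T0 (Suc L) A p = T0 L (A - 1) p + p powi (int L + 1 + A) * V (Suc L) (A + 1) p"
proof -
  have p: "p \<noteq> 0" using assms by (rule generic_nonzero)
  show ?thesis
    unfolding T0_Suc[OF assms] V_eq_shifted[OF assms]
    using p by (simp add: algebra_simps power_int_mult power2_eq_square mult_2 power_int_add)
qed

lemma V_Suc:
  assumes "generic p"
  shows "V (Suc (Suc L)) A p = (1 + p ^ (2 * L + 2)) * V (Suc L) A p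
           + p powi (int L + 1 + A) * T0 L (A + 1) p + p powi (int L + 2 - A) * T0 L (A - 2) p"
proof -
  have p: "p \<noteq> 0" using assms by (rule generic_nonzero)
  have "V (Suc (Suc L)) A p = T1 (Suc L) A p + p powi (int L + 2 - A) * T0 (Suc L) (A - 1) p"
    by (simp add: V_def algebra_simps)
  also have "T0 (Suc L) (A - 1) p = T0 L (A - 2) p + p powi (int L + A) * V (Suc L) A p"
    using T0_Suc_V[OF assms, of L "A - 1"] by (simp add: algebra_simps)
  also have "T1 (Suc L) A p = V (Suc L) A p + p powi (int L + 1 + A) * T0 L (A + 1) p"
    unfolding T1_Suc[OF assms] by (simp add: V_def algebra_simps)
  finally have "V (Suc (Suc L)) A p = V (Suc L) A p + p powi (int L + 1 + A) * T0 L (A + 1) p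
      + p powi (int L + 2 - A) * (T0 L (A - 2) p + p powi (int L + A) * V (Suc L) A p)" .
  moreover have "p powi (int L + 2 - A) * p powi (int L + A) = p ^ (2 * L + 2)"
  proof -
    have *: "int (2 * L + 2) = int L + 2 - A + (int L + A)" by simp
    show ?thesis
      unfolding power_int_of_nat[symmetric] *
      by (rule power_int_add[symmetric]) (use p in simp)
  qed
  ultimately show ?thesis
    by (simp add: algebra_simps)
qed

section \<open>Theta-weighted sums over residue classes modulo 4\<close>

text \<open>
  For \<open>A = 4j + 1\<close> and \<open>p = sqrt q\<close> the exponent \<open>A(A - 1)/2 = 8j\<^sup>2 + 2j\<close> gives \<open>q^(4j\<^sup>2 + j)\<close>.  Written in
  this form, the weight turns a factor \<open>p^A\<close> into the shift \<open>A \<mapsto> A + 1\<close> and is symmetric under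
  \<open>A \<mapsto> 1 - A\<close>.
\<close>

definition theta_weight :: "'a::field \<Rightarrow> int \<Rightarrow> 'a" where
  "theta_weight p A = p powi (A * (A - 1) div 2)"

definition theta_sum :: "'a::field \<Rightarrow> int \<Rightarrow> (int \<Rightarrow> 'a) \<Rightarrow> 'a" where
  "theta_sum p a f = Sum_any (\<lambda>j. (- 1) powi j * theta_weight p (4 * j + a) * f (4 * j + a))"

lemma theta_weight_plus1:
  assumes "p \<noteq> 0"
  shows "theta_weight p (A + 1) = theta_weight p A * p powi A"
proof -
  have "(A + 1) * (A + 1 - 1) = A * (A - 1) + A * 2"
    by (simp add: algebra_simps)
  then have "(A + 1) * (A + 1 - 1) div 2 = A * (A - 1) div 2 + A"
    by simp
  then show ?thesis
    using assms by (simp add: theta_weight_def power_int_add)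
qed

lemma theta_weight_minus: "theta_weight p (- A) = theta_weight p (A + 1)"
  by (simp add: theta_weight_def algebra_simps)

lemma finite_support_theta:
  assumes "finite {A. f A \<noteq> (0::'a::field)}"
  shows "finite {j. (- 1) powi j * theta_weight p (4 * j + a) * f (4 * j + a) \<noteq> 0}"
proof (rule finite_subset)
  show "finite ((\<lambda>j. 4 * j + a) -` {A. f A \<noteq> 0})"
    using assms by (rule finite_vimageI) (simp add: inj_def)
qed auto

lemma theta_sum_add:
  assumes "finite {A. f A \<noteq> 0}" "finite {A. g A \<noteq> 0}"
  shows "theta_sum p a (\<lambda>A. f A + g A) = theta_sum p a f + theta_sum p a g"
  unfolding theta_sum_def distrib_left
  by (rule Sum_any.distrib) (intro finite_support_theta assms)+

lemma theta_sum_scale: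
  assumes "finite {A. f A \<noteq> 0}"
  shows "theta_sum p a (\<lambda>A. c * f A) = c * theta_sum p a f"
  unfolding theta_sum_def Sum_any_right_distrib[OF finite_support_theta[OF assms]]
  by (simp add: mult_ac)

lemma theta_sum_shift:
  assumes "p \<noteq> 0"
  shows "theta_sum p a (\<lambda>A. p powi A * f (A + 1)) = theta_sum p (a + 1) f"
proof -
  have *: "theta_weight p A * (p powi A * f (A + 1)) = theta_weight p (A + 1) * f (A + 1)" for A
    by (simp add: theta_weight_plus1[OF assms])
  show ?thesis
    unfolding theta_sum_def mult.assoc * by (simp only: add.assoc)
qed

lemma theta_sum_pred:
  "theta_sum p a (\<lambda>A. f (A - 1)) = theta_sum p (1 - a) (\<lambda>A. f (- A))"
  unfolding theta_sum_def
proof (rule Sum_any.reindex_cong)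
  show "bij (uminus :: int \<Rightarrow> int)"
    by (rule involuntory_imp_bij) simp
  show "(\<lambda>j. (- 1) powi j * theta_weight p (4 * j + a) * f (4 * j + a - 1)) \<circ> uminus =
    (\<lambda>j. (- 1) powi j * theta_weight p (4 * j + (1 - a)) * f (- (4 * j + (1 - a))))"
  proof
    fix j :: int
    have "theta_weight p (4 * - j + a) = theta_weight p (4 * j + (1 - a))"
      using theta_weight_minus[of p "4 * j - a"] by (simp add: algebra_simps)
    moreover have "(- 1 :: 'a) powi - j = (- 1) powi j"
      by (simp add: power_int_minus flip: power_int_inverse)
    ultimately show "((\<lambda>j. (- 1) powi j * theta_weight p (4 * j + a) * f (4 * j + a - 1)) \<circ> uminus) j =
      (- 1) powi j * theta_weight p (4 * j + (1 - a)) * f (- (4 * j + (1 - a)))"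
      by (simp add: algebra_simps)
  qed
qed

lemma theta_sum_reflect: "theta_sum p a f = theta_sum p (1 - a) (\<lambda>A. f (1 - A))"
  using theta_sum_pred[of p a "\<lambda>A. f (A + 1)"] by simp

lemma theta_sum_antiperiodic:
  "theta_sum p (a + 4) f = - theta_sum p a f"
proof -
  have "theta_sum p (a + 4) f
      = Sum_any (\<lambda>j. - ((- 1) powi j * theta_weight p (4 * j + a) * f (4 * j + a)))"
    unfolding theta_sum_def
  proof (rule Sum_any.reindex_cong)
    show "bij (\<lambda>j::int. j - 1)"
      by (rule bij_betw_byWitness[of _ "\<lambda>j. j + 1"]) auto
    show "(\<lambda>j. (- 1) powi j * theta_weight p (4 * j + (a + 4)) * f (4 * j + (a + 4))) \<circ> (\<lambda>j. j - 1) =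
      (\<lambda>j. - ((- 1) powi j * theta_weight p (4 * j + a) * f (4 * j + a)))"
      by (auto simp: fun_eq_iff power_int_diff algebra_simps)
  qed
  also have "\<dots> = - theta_sum p a f"
    unfolding theta_sum_def by (simp add: Sum_any.expand_set sum_negf)
  finally show ?thesis .
qed

lemma finite_support_T0: "finite {A. T0 L A p \<noteq> 0}"
  by (rule finite_subset[of _ "{- int L .. int L}"]) (use T0_eq_0[of L _ p] in force)+

lemma finite_support_V_index: "finite {A. V (Suc L) A p \<noteq> 0}"
proof (rule finite_subset[of _ "{- int L - 1 .. int L + 1}"])
  show "{A. V (Suc L) A p \<noteq> 0} \<subseteq> {- int L - 1 .. int L + 1}"
  proof
    fix A assume "A \<in> {A. V (Suc L) A p \<noteq> 0}"
    then have "T1 L A p \<noteq> 0 \<or> T0 L (A - 1) p \<noteq> 0"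
      by (auto simp: V_def)
    then show "A \<in> {- int L - 1 .. int L + 1}"
      using T0_eq_0[of L "A - 1" p] T1_eq_0[of L A p] by force
  qed
qed simp

lemma finite_support_comp_plus:
  fixes f :: "int \<Rightarrow> 'a::zero"
  assumes "finite {A. f A \<noteq> 0}"
  shows "finite {A. f (A + c) \<noteq> 0}"
proof -
  have "finite ((\<lambda>A. A + c) -` {A. f A \<noteq> 0})"
    using assms by (rule finite_vimageI) (simp add: inj_def)
  then show ?thesis by (simp add: vimage_def)
qed

lemma finite_support_mult:
  fixes f :: "int \<Rightarrow> 'a::mult_zero"
  assumes "finite {A. f A \<noteq> 0}"
  shows "finite {A. g A * f A \<noteq> 0}"
  by (rule finite_subset[OF _ assms]) auto

lemma finite_support_add:
  fixes f g :: "int \<Rightarrow> 'a::monoid_add"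
  assumes "finite {A. f A \<noteq> 0}" "finite {A. g A \<noteq> 0}"
  shows "finite {A. f A + g A \<noteq> 0}"
  by (rule finite_subset[OF _ finite_UnI[OF assms]]) auto

lemma theta_sum_T0_Suc:
  assumes "generic p"
  shows "theta_sum p a (\<lambda>A. T0 (Suc L) A p) = theta_sum p (1 - a) (\<lambda>A. T0 L A p)
           + p ^ (L + 1) * theta_sum p (a + 1) (\<lambda>A. V (Suc L) A p)"
proof -
  have p: "p \<noteq> 0" using assms by (rule generic_nonzero)
  have fV: "finite {A. p powi A * V (Suc L) (A + 1) p \<noteq> 0}"
    using finite_support_comp_plus[OF finite_support_V_index, where c = 1] by (rule finite_support_mult)
  have fT: "finite {A. T0 L (A - 1) p \<noteq> 0}"
    using finite_support_comp_plus[OF finite_support_T0, where c = "- 1"] by simp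
  have "T0 (Suc L) A p = T0 L (A - 1) p + p ^ (L + 1) * (p powi A * V (Suc L) (A + 1) p)" for A
    unfolding T0_Suc_V[OF assms] using p by (simp add: power_int_add)
  then show ?thesis
    using fV fT
    by (simp only: theta_sum_add theta_sum_scale theta_sum_shift[OF p, where f = "\<lambda>A. V (Suc L) A p"]
        theta_sum_pred[where f = "\<lambda>A. T0 L A p"] finite_support_mult T0_minus)
qed

lemma theta_sum_V_Suc:
  assumes "generic p"
  shows "theta_sum p a (\<lambda>A. V (Suc (Suc L)) A p)
           = (1 + p ^ (2 * L + 2)) * theta_sum p a (\<lambda>A. V (Suc L) A p)
             + p ^ (L + 1) * theta_sum p (a + 1) (\<lambda>A. T0 L A p)
             + p ^ (L + 1) * theta_sum p (2 - a) (\<lambda>A. T0 L A p)"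
proof -
  have p: "p \<noteq> 0" using assms by (rule generic_nonzero)
  have f1: "finite {A. p powi A * T0 L (A + 1) p \<noteq> 0}"
    using finite_support_comp_plus[OF finite_support_T0, where c = 1] by (rule finite_support_mult)
  have f2: "finite {A. p powi (1 - A) * T0 L (A - 2) p \<noteq> 0}"
    using finite_support_comp_plus[OF finite_support_T0, where c = "- 2"]
    by (intro finite_support_mult) simp
  have "V (Suc (Suc L)) A p = (1 + p ^ (2 * L + 2)) * V (Suc L) A p
      + (p ^ (L + 1) * (p powi A * T0 L (A + 1) p)
      + p ^ (L + 1) * (p powi (1 - A) * T0 L (A - 2) p))" for A
    unfolding V_Suc[OF assms] using p
    by (simp add: power_int_add power_int_diff power2_eq_square power_add)
  then have "theta_sum p a (\<lambda>A. V (Suc (Suc L)) A p)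
      = (1 + p ^ (2 * L + 2)) * theta_sum p a (\<lambda>A. V (Suc L) A p)
        + (p ^ (L + 1) * theta_sum p a (\<lambda>A. p powi A * T0 L (A + 1) p)
        + p ^ (L + 1) * theta_sum p a (\<lambda>A. p powi (1 - A) * T0 L (A - 2) p))"
    by (simp only: theta_sum_add theta_sum_scale finite_support_add finite_support_mult
        finite_support_V_index f1 f2)
  also have "theta_sum p a (\<lambda>A. p powi A * T0 L (A + 1) p) = theta_sum p (a + 1) (\<lambda>A. T0 L A p)"
    by (rule theta_sum_shift[OF p])
  also have "theta_sum p a (\<lambda>A. p powi (1 - A) * T0 L (A - 2) p) = theta_sum p (2 - a) (\<lambda>A. T0 L A p)"
  proof -
    have "theta_weight p (B + 1) * p powi (1 - (B + 1)) = theta_weight p B" for B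
      unfolding theta_weight_plus1[OF p] using p by (simp add: power_int_minus)
    then have *: "theta_weight p A * p powi (1 - A) = theta_weight p (A - 1)" for A
      by (metis diff_add_cancel)
    have "theta_sum p a (\<lambda>A. p powi (1 - A) * T0 L (A - 2) p)
        = theta_sum p (a - 1) (\<lambda>A. T0 L (A - 1) p)"
      unfolding theta_sum_def mult.assoc[of "(- 1) powi _"] mult.assoc[symmetric, of "theta_weight p _"] *
      by (simp add: algebra_simps)
    also have "\<dots> = theta_sum p (2 - a) (\<lambda>A. T0 L A p)"
      using theta_sum_pred[of p "a - 1" "\<lambda>A. T0 L A p"] by (simp add: T0_minus)
    finally show ?thesis .
  qed
  finally show ?thesis by (simp only: add.assoc)
qed

lemma theta_sum_initial:
  assumes "\<And>A. f A = (if A = 0 then 1 else 0)" "\<bar>a\<bar> < 4"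
  shows "theta_sum p a f = (if a = 0 then 1 else 0)"
proof -
  have "4 * j + a = 0 \<longleftrightarrow> j = 0 \<and> a = 0" for j
    using assms(2) by presburger
  then have "theta_sum p a f = Sum_any (\<lambda>j::int. if j = 0 then (if a = 0 then 1 else 0) else 0)"
    unfolding theta_sum_def assms(1) by (intro Sum_any.cong) (auto simp: theta_weight_def)
  then show ?thesis by simp
qed

text \<open>
  The sum of interest, and two auxiliary sums over residue classes modulo 4: the classes 1 and 2, and
  their images 0 and \<open>-1\<close> under \<open>a \<mapsto> 1 - a\<close>.  These three sequences close up under a linear system.
\<close>

definition theta_V :: "'a::field \<Rightarrow> nat \<Rightarrow> 'a" where
  "theta_V p n = theta_sum p 1 (\<lambda>A. V (Suc n) A p)"

definition theta_T0_pos :: "'a::field \<Rightarrow> nat \<Rightarrow> 'a" where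
  "theta_T0_pos p n = theta_sum p 1 (\<lambda>A. T0 n A p) + theta_sum p 2 (\<lambda>A. T0 n A p)"

definition theta_T0_neg :: "'a::field \<Rightarrow> nat \<Rightarrow> 'a" where
  "theta_T0_neg p n = theta_sum p 0 (\<lambda>A. T0 n A p) + theta_sum p (- 1) (\<lambda>A. T0 n A p)"

lemma theta_V_Suc:
  assumes "generic p"
  shows "theta_V p (Suc n) = (1 + p ^ (2 * n + 2)) * theta_V p n + p ^ (n + 1) * theta_T0_pos p n"
  unfolding theta_V_def theta_T0_pos_def
  using theta_sum_V_Suc[OF assms, of 1 n] by (simp add: algebra_simps)

lemma theta_sum_V_reflect:
  assumes "generic p"
  shows "theta_sum p (1 - a) (\<lambda>A. V (Suc n) A p) = theta_sum p a (\<lambda>A. V (Suc n) A p)"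
  using theta_sum_reflect[of p a "\<lambda>A. V (Suc n) A p"] by (simp only: V_reflect[OF assms])

text \<open>
  The two contributions of \<open>V\<close> come from the classes 2 and 3.  The class 3 is \<open>-1\<close> shifted by
  one antiperiod, and reflection sends \<open>-1\<close> to 2, so they cancel.
\<close>

lemma theta_T0_pos_Suc:
  assumes "generic p"
  shows "theta_T0_pos p (Suc n) = theta_T0_neg p n"
proof -
  have "theta_sum p 3 (\<lambda>A. V (Suc n) A p) = - theta_sum p (- 1) (\<lambda>A. V (Suc n) A p)"
    using theta_sum_antiperiodic[of p "- 1"] by simp
  also have "\<dots> = - theta_sum p 2 (\<lambda>A. V (Suc n) A p)"
    using theta_sum_V_reflect[OF assms, of 2] by simp
  finally show ?thesis
    unfolding theta_T0_pos_def theta_T0_neg_def theta_sum_T0_Suc[OF assms] by (simp add: algebra_simps)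
qed

text \<open>
  Now the contributions of \<open>V\<close> come from the classes 1 and 0, which reflection identifies, so they add.
\<close>

lemma theta_T0_neg_Suc:
  assumes "generic p"
  shows "theta_T0_neg p (Suc n) = theta_T0_pos p n + 2 * p ^ (n + 1) * theta_V p n"
  unfolding theta_T0_pos_def theta_T0_neg_def theta_V_def theta_sum_T0_Suc[OF assms]
  using theta_sum_V_reflect[OF assms, of 1] by (simp add: algebra_simps)

lemma T0_0: "T0 0 A p = (if A = 0 then 1 else 0)"
  by (auto simp: T0_def gauss_binom_def)

lemma T1_0: "T1 0 A p = (if A = 0 then 1 else 0)"
  by (auto simp: T1_def gauss_binom_def)

lemma theta_initial: "theta_V p 0 = 1" "theta_T0_pos p 0 = 0" "theta_T0_neg p 0 = 1"
proof -
  have "4 * j + 1 \<noteq> (0::int)" for j by presburger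
  then have "theta_V p 0 = Sum_any (\<lambda>j::int. if j = 0 then 1 else 0)"
    unfolding theta_V_def theta_sum_def V_def
    by (intro Sum_any.cong) (auto simp: theta_weight_def T0_0 T1_0)
  then show "theta_V p 0 = 1" by simp
qed (simp_all add: theta_T0_pos_def theta_T0_neg_def theta_sum_initial T0_0)

text \<open>
  Eliminating the auxiliary sums: two steps of the system change \<open>theta_T0_pos\<close> only by a multiple
  of \<open>theta_V\<close>, and the remaining \<open>theta_T0_pos p n\<close> is expressed by the first step for \<open>theta_V\<close>.
\<close>

lemma theta_V_recurrence:
  assumes "generic p"
  shows "theta_V p (n + 3) = (1 + (p\<^sup>2) ^ (n + 3)) * theta_V p (n + 2) + p\<^sup>2 * theta_V p (n + 1)
           + ((p\<^sup>2) ^ (n + 2) - p\<^sup>2) * theta_V p n"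
proof -
  have 3: "theta_V p (n + 3) = (1 + p ^ (2 * n + 6)) * theta_V p (n + 2) + p ^ (n + 3) * theta_T0_pos p (n + 2)"
    using theta_V_Suc[OF assms, of "n + 2"] by (simp add: eval_nat_numeral)
  have 1: "theta_V p (n + 1) = (1 + p ^ (2 * n + 2)) * theta_V p n + p ^ (n + 1) * theta_T0_pos p n"
    using theta_V_Suc[OF assms, of n] by simp
  have "theta_T0_pos p (n + 2) = theta_T0_pos p n + 2 * p ^ (n + 1) * theta_V p n"
    using theta_T0_pos_Suc[OF assms, of "n + 1"] theta_T0_neg_Suc[OF assms, of n] by simp
  then show ?thesis
    unfolding 3 1 by (simp add: power_add algebra_simps eval_nat_numeral power_mult_distrib)
qed

lemma theta_V_012:
  assumes "generic p"
  shows "theta_V p 0 = 1" "theta_V p 1 = p\<^sup>2 + 1" "theta_V p 2 = (p\<^sup>2) ^ 3 + (p\<^sup>2) ^ 2 + 2 * p\<^sup>2 + 1"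
proof -
  show 0: "theta_V p 0 = 1" by (rule theta_initial)
  show 1: "theta_V p 1 = p\<^sup>2 + 1"
    using theta_V_Suc[OF assms, of 0] by (simp add: theta_initial power2_eq_square)
  have "theta_T0_pos p 1 = 1"
    using theta_T0_pos_Suc[OF assms, of 0] by (simp add: theta_initial)
  then show "theta_V p 2 = (p\<^sup>2) ^ 3 + (p\<^sup>2) ^ 2 + 2 * p\<^sup>2 + 1"
    using theta_V_Suc[OF assms, of 1] 1 by (simp add: eval_nat_numeral algebra_simps)
qed

section \<open>The generating function of the triple sum\<close>

unbundle fps_syntax

definition even_fps :: "(nat \<Rightarrow> 'a::comm_ring_1) \<Rightarrow> 'a fps" where
  "even_fps c = Abs_fps (\<lambda>n. if even n then c (n div 2) else 0)"

lemma even_fps_mult_nth: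
  "(even_fps c * f) $ n = (\<Sum>k\<le>n. if 2 * k \<le> n then c k * f $ (n - 2 * k) else 0)"
proof -
  have "(even_fps c * f) $ n = (\<Sum>m\<in>{0..n}. (if even m then c (m div 2) else 0) * f $ (n - m))"
    by (simp add: fps_mult_nth even_fps_def)
  also have "\<dots> = (\<Sum>m | m \<le> n \<and> even m. c (m div 2) * f $ (n - m))"
    by (rule sum.mono_neutral_cong_right) auto
  also have "\<dots> = (\<Sum>k | k \<le> n \<and> 2 * k \<le> n. c k * f $ (n - 2 * k))"
    by (rule sum.reindex_bij_witness[of _ "\<lambda>k. 2 * k" "\<lambda>m. m div 2"]) auto
  also have "\<dots> = (\<Sum>k\<le>n. if 2 * k \<le> n then c k * f $ (n - 2 * k) else 0)"
    by (rule sum.mono_neutral_cong_left) auto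
  finally show ?thesis .
qed

lemma even_fps_linear_factor:
  "(1 + fps_const t * fps_X ^ 2) * even_fps c = even_fps (\<lambda>k. c k + (if k = 0 then 0 else t * c (k - 1)))"
proof (rule fps_ext)
  fix n
  have "((1 + fps_const t * fps_X ^ 2) * even_fps c) $ n
      = even_fps c $ n + t * (if n < 2 then 0 else even_fps c $ (n - 2))"
    by (simp add: distrib_right mult.assoc fps_X_power_mult_nth)
  then show "((1 + fps_const t * fps_X ^ 2) * even_fps c) $ n
      = even_fps (\<lambda>k. c k + (if k = 0 then 0 else t * c (k - 1))) $ n"
  proof (cases "n < 2")
    case True
    then have "n = 0 \<or> n = 1" by auto
    then show ?thesis
      using \<open>_ = even_fps c $ n + _\<close> by (auto simp: even_fps_def)
  next
    case False
    then obtain m where "n = Suc (Suc m)"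
      by (metis add_2_eq_Suc le_Suc_ex not_less)
    then show ?thesis
      using \<open>_ = even_fps c $ n + _\<close> by (simp add: even_fps_def)
  qed
qed

lemma even_fps_delta: "even_fps (\<lambda>k. if k = 0 then 1 else 0) = 1"
proof (rule fps_ext)
  fix n
  show "even_fps (\<lambda>k. if k = 0 then 1 else 0 :: 'a) $ n = 1 $ n"
    by (cases "even n"; cases "n = 0") (auto simp: even_fps_def)
qed

definition dilate :: "'a::comm_ring_1 \<Rightarrow> 'a fps \<Rightarrow> 'a fps" where
  "dilate c f = Abs_fps (\<lambda>n. c ^ n * f $ n)"

lemma dilate_nth [simp]: "dilate c f $ n = c ^ n * f $ n"
  by (simp add: dilate_def)

lemma dilate_add: "dilate c (f + g) = dilate c f + dilate c g"
  by (simp add: fps_eq_iff algebra_simps)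

lemma dilate_diff: "dilate c (f - g) = dilate c f - dilate c g"
  by (simp add: fps_eq_iff algebra_simps)

lemma dilate_mult: "dilate c (f * g) = dilate c f * dilate c g"
proof (rule fps_ext)
  fix n
  have "c ^ n * (\<Sum>i=0..n. f $ i * g $ (n - i)) = (\<Sum>i=0..n. (c ^ i * f $ i) * (c ^ (n - i) * g $ (n - i)))"
    unfolding sum_distrib_left
  proof (rule sum.cong)
    fix i assume "i \<in> {0..n}"
    then have "c ^ n = c ^ i * c ^ (n - i)" by (simp flip: power_add)
    then show "c ^ n * (f $ i * g $ (n - i)) = (c ^ i * f $ i) * (c ^ (n - i) * g $ (n - i))"
      by simp
  qed simp
  then show "dilate c (f * g) $ n = (dilate c f * dilate c g) $ n"
    by (simp add: fps_mult_nth)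
qed

lemma dilate_1 [simp]: "dilate c 1 = 1"
  by (simp add: fps_eq_iff)

lemma dilate_const [simp]: "dilate c (fps_const a) = fps_const a"
  by (simp add: fps_eq_iff)

lemma dilate_X [simp]: "dilate c fps_X = fps_const c * fps_X"
  by (simp add: fps_eq_iff fps_X_def)

lemma dilate_power: "dilate c (f ^ n) = dilate c f ^ n"
  by (induction n) (simp_all add: dilate_mult)

lemma dilate_prod: "dilate c (prod f A) = (\<Prod>i\<in>A. dilate c (f i))"
  by (induction A rule: infinite_finite_induct) (simp_all add: dilate_mult)

lemma dilate_sum: "dilate c (sum f A) = (\<Sum>i\<in>A. dilate c (f i))"
  by (simp add: fps_eq_iff fps_sum_nth sum_distrib_left)

text \<open>
  The three factors of the generating function \<open>\<Sum>n. P n q X^n\<close> for fixed \<open>j\<close>; the three lemmas that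
  follow evaluate them as products or reciprocals of products, by induction on \<open>j\<close> with Pascal's rule.
\<close>

definition column_fps :: "'a::field \<Rightarrow> nat \<Rightarrow> 'a fps" where
  "column_fps q j = Abs_fps (\<lambda>m. gauss_binom q (int m) (int j))"

definition product_fps :: "'a::field \<Rightarrow> nat \<Rightarrow> 'a fps" where
  "product_fps q j = even_fps (\<lambda>i. q ^ i\<^sup>2 * gauss_binom (q\<^sup>2) (int j) (int i))"

definition reciprocal_fps :: "'a::field \<Rightarrow> nat \<Rightarrow> 'a fps" where
  "reciprocal_fps q j = even_fps (\<lambda>k. q ^ k * gauss_binom (q\<^sup>2) (int j + int k) (int k))"

lemma column_fps_times:
  assumes "generic q"
  shows "(\<Prod>i<Suc j. 1 - fps_const (q ^ i) * fps_X) * column_fps q j = fps_X ^ j"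
proof (induction j)
  case 0
  show ?case
  proof (rule fps_ext)
    fix n
    show "((\<Prod>i<Suc 0. 1 - fps_const (q ^ i) * fps_X) * column_fps q 0) $ n = fps_X ^ 0 $ n"
      by (cases n) (simp_all add: column_fps_def assms left_diff_distrib)
  qed
next
  case (Suc j)
  have "(1 - fps_const (q ^ Suc j) * fps_X) * column_fps q (Suc j) = fps_X * column_fps q j"
  proof (rule fps_ext)
    fix n
    show "((1 - fps_const (q ^ Suc j) * fps_X) * column_fps q (Suc j)) $ n = (fps_X * column_fps q j) $ n"
    proof (cases n)
      case 0
      then show ?thesis by (simp add: column_fps_def gauss_binom_eq_0)
    next
      case (Suc m)
      have "gauss_binom q (int (Suc m)) (int (Suc j))
          = gauss_binom q (int m) (int j) + q ^ Suc j * gauss_binom q (int m) (int (Suc j))"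
        using gauss_binom_Pascal1[OF assms, of "int m" "int (Suc j)"]
        unfolding power_int_of_nat by (simp add: add.commute)
      then show ?thesis
        unfolding Suc left_diff_distrib mult.assoc
        by (simp add: column_fps_def del: power_Suc of_nat_Suc)
    qed
  qed
  then have "(\<Prod>i<Suc (Suc j). 1 - fps_const (q ^ i) * fps_X) * column_fps q (Suc j)
      = (\<Prod>i<Suc j. 1 - fps_const (q ^ i) * fps_X) * (fps_X * column_fps q j)"
    by (subst prod.lessThan_Suc) (simp only: mult.assoc)
  also have "\<dots> = fps_X ^ Suc j"
    using Suc.IH by (simp only: mult.left_commute[of _ fps_X] power_Suc)
  finally show ?case .
qed

lemma product_fps_eq:
  assumes "generic q"
  shows "product_fps q j = (\<Prod>i<j. 1 + fps_const (q ^ (2 * i + 1)) * fps_X ^ 2)"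
proof (induction j)
  case 0
  have "(\<lambda>i. q ^ i\<^sup>2 * gauss_binom (q\<^sup>2) (int 0) (int i)) = (\<lambda>i. if i = 0 then 1 else 0)"
    by (auto simp: gauss_binom_eq_0 assms generic_power2)
  then show ?case
    unfolding product_fps_def by (simp only: even_fps_delta) simp
next
  case (Suc j)
  have "product_fps q (Suc j) = (1 + fps_const (q ^ (2 * j + 1)) * fps_X ^ 2) * product_fps q j"
    unfolding product_fps_def even_fps_linear_factor
  proof (rule arg_cong[of _ _ even_fps], rule ext)
    fix i
    show "q ^ i\<^sup>2 * gauss_binom (q\<^sup>2) (int (Suc j)) (int i) = q ^ i\<^sup>2 * gauss_binom (q\<^sup>2) (int j) (int i) +
         (if i = 0 then 0 else q ^ (2 * j + 1) * (q ^ (i - 1)\<^sup>2 * gauss_binom (q\<^sup>2) (int j) (int (i - 1))))"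
    proof (cases "i = 0 \<or> i > Suc j")
      case True
      then show ?thesis by (auto simp: gauss_binom_eq_0 assms generic_power2)
    next
      case False
      then obtain m r where i: "i = Suc m" and j: "j = m + r"
        by (metis not_less Suc_le_mono le_Suc_ex not0_implies_Suc)
      have "int j + 1 - int i = int r" by (simp add: i j)
      then have "(q\<^sup>2) powi (int j + 1 - int i) = q ^ (2 * r)"
        by (simp only: power_int_of_nat power_mult)
      moreover have "q ^ i\<^sup>2 * q ^ (2 * r) = q ^ (2 * j + 1) * q ^ m\<^sup>2"
      proof -
      have "i\<^sup>2 + 2 * r = 2 * j + 1 + m\<^sup>2"
        unfolding i j by (simp add: power2_eq_square)
      then show ?thesis by (simp only: flip: power_add)
    qed
      ultimately show ?thesis
        using gauss_binom_Pascal2[OF generic_power2[OF assms], of "int j" "int i"] False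
        by (simp add: i add.commute[of 1] distrib_left mult.assoc[symmetric])
    qed
  qed
  then show ?case by (simp add: Suc.IH mult.commute)
qed

lemma reciprocal_fps_times:
  assumes "generic q"
  shows "(\<Prod>i<Suc j. 1 - fps_const (q ^ (2 * i + 1)) * fps_X ^ 2) * reciprocal_fps q j = 1"
proof (induction j)
  case 0
  have "(1 + fps_const (- q) * fps_X ^ 2) * reciprocal_fps q 0 = even_fps (\<lambda>k. if k = 0 then 1 else 0)"
    unfolding reciprocal_fps_def even_fps_linear_factor
  proof (rule arg_cong[of _ _ even_fps], rule ext)
    fix k
    show "q ^ k * gauss_binom (q\<^sup>2) (int 0 + int k) (int k) +
        (if k = 0 then 0 else - q * (q ^ (k - 1) * gauss_binom (q\<^sup>2) (int 0 + int (k - 1)) (int (k - 1))))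
      = (if k = 0 then 1 else 0)"
      by (cases k) (simp_all add: gauss_binom_self assms generic_power2 del: of_nat_Suc)
  qed
  then show ?case by (simp add: even_fps_delta flip: fps_const_neg)
next
  case (Suc j)
  have "(1 + fps_const (- (q ^ (2 * Suc j + 1))) * fps_X ^ 2) * reciprocal_fps q (Suc j) = reciprocal_fps q j"
    unfolding reciprocal_fps_def even_fps_linear_factor
  proof (rule arg_cong[of _ _ even_fps], rule ext)
    fix k
    show "q ^ k * gauss_binom (q\<^sup>2) (int (Suc j) + int k) (int k) +
         (if k = 0 then 0 else - (q ^ (2 * Suc j + 1)) *
            (q ^ (k - 1) * gauss_binom (q\<^sup>2) (int (Suc j) + int (k - 1)) (int (k - 1))))
       = q ^ k * gauss_binom (q\<^sup>2) (int j + int k) (int k)"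
    proof (cases k)
      case 0
      then show ?thesis by (simp add: assms generic_power2)
    next
      case (Suc m)
      have "int j + int k + 1 - int k = int (Suc j)" by simp
      then have "(q\<^sup>2) powi (int j + int k + 1 - int k) = q ^ (2 * Suc j)"
        by (simp only: power_int_of_nat power_mult)
      then have "gauss_binom (q\<^sup>2) (int j + int k + 1) (int k) = gauss_binom (q\<^sup>2) (int j + int k) (int k)
          + q ^ (2 * Suc j) * gauss_binom (q\<^sup>2) (int j + int k) (int k - 1)"
        using gauss_binom_Pascal2[OF generic_power2[OF assms], of "int j + int k" "int k"] by simp
      moreover have "int (Suc j) + int k = int j + int k + 1" "int (Suc j) + int (k - 1) = int j + int k"
        "int (k - 1) = int k - 1"
        using Suc by simp_all
      ultimately show ?thesis
        using Suc by (simp only:) (simp add: algebra_simps)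
    qed
  qed
  then have "(1 - fps_const (q ^ (2 * Suc j + 1)) * fps_X ^ 2) * reciprocal_fps q (Suc j) = reciprocal_fps q j"
    by (simp flip: fps_const_neg)
  then show ?case
    using Suc.IH by (subst prod.lessThan_Suc) (simp only: mult.assoc)
qed

definition term_fps :: "'a::field \<Rightarrow> nat \<Rightarrow> 'a fps" where
  "term_fps q j = fps_const (q ^ (j * (j + 1) div 2)) * (product_fps q j * (reciprocal_fps q j * column_fps q j))"

text \<open>
  Working with the product of \<open>term_fps\<close> and this denominator avoids inverting power series.
\<close>

definition denom_fps :: "'a::field \<Rightarrow> nat \<Rightarrow> 'a fps" where
  "denom_fps q j = (\<Prod>i<Suc j. 1 - fps_const (q ^ i) * fps_X)
                 * (\<Prod>i<Suc j. 1 - fps_const (q ^ (2 * i + 1)) * fps_X ^ 2)"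

lemma term_fps_times_denom:
  assumes "generic q"
  shows "denom_fps q j * term_fps q j = fps_const (q ^ (j * (j + 1) div 2)) * fps_X ^ j * product_fps q j"
proof -
  have "denom_fps q j * term_fps q j = fps_const (q ^ (j * (j + 1) div 2)) * product_fps q j
     * ((\<Prod>i<Suc j. 1 - fps_const (q ^ (2 * i + 1)) * fps_X ^ 2) * reciprocal_fps q j)
     * ((\<Prod>i<Suc j. 1 - fps_const (q ^ i) * fps_X) * column_fps q j)"
    unfolding denom_fps_def term_fps_def by (simp only: mult_ac)
  then show ?thesis
    unfolding column_fps_times[OF assms] reciprocal_fps_times[OF assms] by (simp only: mult_ac mult_1_left)
qed

lemma dilate_linear:
  "dilate q (1 - fps_const (q ^ i) * fps_X) = 1 - fps_const (q ^ Suc i) * fps_X"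
  by (simp add: dilate_diff dilate_mult mult_ac flip: fps_const_mult)

lemma dilate_quadratic:
  "dilate q (1 + fps_const (q ^ (2 * i + 1)) * fps_X ^ 2) = 1 + fps_const (q ^ (2 * Suc i + 1)) * fps_X ^ 2"
  "dilate q (1 - fps_const (q ^ (2 * i + 1)) * fps_X ^ 2) = 1 - fps_const (q ^ (2 * Suc i + 1)) * fps_X ^ 2"
  by (simp_all add: dilate_add dilate_diff dilate_mult dilate_power power2_eq_square mult_ac
      flip: fps_const_mult)

lemma denom_fps_dilate:
  "denom_fps q (Suc j) = (1 - fps_X) * (1 - fps_const q * fps_X ^ 2) * dilate q (denom_fps q j)"
  unfolding denom_fps_def dilate_mult[of _ "prod _ _"] dilate_prod dilate_linear dilate_quadratic
    prod.lessThan_Suc_shift[of _ "Suc j"]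
  by (simp add: mult_ac del: prod.lessThan_Suc)

lemma product_fps_dilate:
  assumes "generic q"
  shows "product_fps q (Suc j) = (1 + fps_const q * fps_X ^ 2) * dilate q (product_fps q j)"
  unfolding product_fps_eq[OF assms] dilate_prod dilate_quadratic prod.lessThan_Suc_shift[of _ "j"]
  by (simp only: mult_0_right add_0 power_one_right)

lemma denom_fps_nonzero: "denom_fps q j \<noteq> 0"
proof -
  have "1 - fps_const a * fps_X \<noteq> 0" for a :: 'a
    by (rule fps_nonzeroI[of _ 0]) simp
  moreover have "1 - fps_const a * fps_X\<^sup>2 \<noteq> 0" for a :: 'a
    by (rule fps_nonzeroI[of _ 0]) simp
  ultimately show ?thesis
    by (simp add: denom_fps_def del: prod.lessThan_Suc)
qed

lemma dilate_nonzero: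
  fixes c :: "'a::field"
  assumes "c \<noteq> 0" "f \<noteq> 0"
  shows "dilate c f \<noteq> 0"
  using assms by (simp add: fps_eq_iff)

lemma term_fps_0:
  assumes "generic q"
  shows "(1 - fps_X) * (1 - fps_const q * fps_X ^ 2) * term_fps q 0 = 1"
  using term_fps_times_denom[OF assms, of 0] product_fps_eq[OF assms, of 0]
  by (simp add: denom_fps_def)

text \<open>
  In the closed form \<open>q^(j(j+1)/2) X^j (-qX\<^sup>2;q\<^sup>2)_j / ((X;q)_(j+1) (qX\<^sup>2;q\<^sup>2)_(j+1))\<close> of \<open>term_fps q j\<close>,
  replacing \<open>X\<close> by \<open>qX\<close> shifts every product by one factor, so the ratio of the next term to the
  dilated one is a rational function independent of \<open>j\<close>.
\<close>

lemma term_fps_Suc: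
  assumes "generic q"
  shows "(1 - fps_X) * (1 - fps_const q * fps_X ^ 2) * term_fps q (Suc j)
     = fps_const q * fps_X * (1 + fps_const q * fps_X ^ 2) * dilate q (term_fps q j)"
proof -
  let ?e = "q ^ (j * (j + 1) div 2)"
  let ?D = "dilate q (denom_fps q j)"
  have "Suc j * (Suc j + 1) = j * (j + 1) + (j + 1) * 2" by (simp add: algebra_simps)
  then have "Suc j * (Suc j + 1) div 2 = j * (j + 1) div 2 + (j + 1)" by simp
  then have e: "q ^ (Suc j * (Suc j + 1) div 2) = ?e * q ^ (j + 1)"
    by (simp only: power_add)
  have "?D * ((1 - fps_X) * (1 - fps_const q * fps_X ^ 2) * term_fps q (Suc j))
      = denom_fps q (Suc j) * term_fps q (Suc j)"
    unfolding denom_fps_dilate by (simp only: mult_ac)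
  also have "\<dots> = fps_const (?e * q ^ (j + 1)) * fps_X ^ Suc j
      * ((1 + fps_const q * fps_X ^ 2) * dilate q (product_fps q j))"
    unfolding term_fps_times_denom[OF assms] e product_fps_dilate[OF assms] ..
  also have "\<dots> = fps_const q * fps_X * (1 + fps_const q * fps_X ^ 2)
      * dilate q (fps_const ?e * fps_X ^ j * product_fps q j)"
    by (simp add: dilate_mult dilate_power power_mult_distrib mult_ac flip: fps_const_mult)
  also have "\<dots> = ?D * (fps_const q * fps_X * (1 + fps_const q * fps_X ^ 2) * dilate q (term_fps q j))"
    unfolding term_fps_times_denom[OF assms, symmetric] dilate_mult by (simp only: mult_ac)
  finally show ?thesis
    using dilate_nonzero[OF generic_nonzero[OF assms] denom_fps_nonzero[of q j]] by simp
qed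

lemma term_fps_nth:
  assumes "n \<le> N"
  shows "term_fps q j $ n = (\<Sum>i\<le>N. \<Sum>k\<le>N. P_term n q i j k)"
proof -
  have trunc: "(\<Sum>k\<le>m. if 2 * k \<le> m then f k else 0) = (\<Sum>k\<le>N. if 2 * k \<le> m then f k else (0::'a))"
    if "m \<le> N" for m f
    using that by (intro sum.mono_neutral_left) auto
  have "term_fps q j $ n = q ^ (j * (j + 1) div 2) *
      (\<Sum>i\<le>N. if 2 * i \<le> n then q ^ i\<^sup>2 * gauss_binom (q\<^sup>2) (int j) (int i) *
        (\<Sum>k\<le>N. if 2 * k \<le> n - 2 * i then q ^ k * gauss_binom (q\<^sup>2) (int j + int k) (int k) *
           gauss_binom q (int (n - 2 * i - 2 * k)) (int j) else 0) else 0)"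
    unfolding term_fps_def product_fps_def reciprocal_fps_def using assms
    by (simp add: even_fps_mult_nth trunc column_fps_def cong: if_cong)
  also have "\<dots> = (\<Sum>i\<le>N. \<Sum>k\<le>N. P_term n q i j k)"
    unfolding sum_distrib_left[of "q ^ (j * (j + 1) div 2)"]
  proof (intro sum.cong refl)
    fix i
    have *: "q ^ (j * (j + 1) div 2) * (q ^ i\<^sup>2 * gauss_binom (q\<^sup>2) (int j) (int i) *
        (if 2 * k \<le> n - 2 * i then q ^ k * gauss_binom (q\<^sup>2) (int j + int k) (int k) *
           gauss_binom q (int (n - 2 * i - 2 * k)) (int j) else 0)) = P_term n q i j k"
      if "2 * i \<le> n" for k
    proof (cases "2 * k \<le> n - 2 * i")
      case True
      then have "int (n - 2 * i - 2 * k) = int n - 2 * int i - 2 * int k"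
        using that by simp
      with True show ?thesis
        by (simp add: P_term_def power_add mult_ac)
    next
      case False
      then have "int n - 2 * int i - 2 * int k < int j"
        using that by linarith
      with False show ?thesis
        by (simp add: P_term_def gauss_binom_eq_0)
    qed
    show "q ^ (j * (j + 1) div 2) * (if 2 * i \<le> n then q ^ i\<^sup>2 * gauss_binom (q\<^sup>2) (int j) (int i) *
        (\<Sum>k\<le>N. if 2 * k \<le> n - 2 * i then q ^ k * gauss_binom (q\<^sup>2) (int j + int k) (int k) *
           gauss_binom q (int (n - 2 * i - 2 * k)) (int j) else 0) else 0)
      = (\<Sum>k\<le>N. P_term n q i j k)"
    proof (cases "2 * i \<le> n")
      case True
      then show ?thesis
        by (simp only: if_True sum_distrib_left *)
    next
      case False
      then have "P_term n q i j k = 0" for k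
        by (simp add: P_term_def gauss_binom_eq_0)
      with False show ?thesis by simp
    qed
  qed
  finally show ?thesis .
qed

lemma Sum_any_atMost:
  fixes f :: "nat \<Rightarrow> 'a::comm_monoid_add"
  assumes "\<And>i. i > N \<Longrightarrow> f i = 0"
  shows "Sum_any f = (\<Sum>i\<le>N. f i)"
  using assms by (intro Sum_any.expand_superset) (auto simp: not_le[symmetric])

lemma P_eq_sum_term_fps:
  assumes "n \<le> N"
  shows "P n q = (\<Sum>j\<le>N. term_fps q j $ n)"
proof -
  have 0: "P_term n q i j k = 0" if "i > N \<or> j > N \<or> k > N" for i j k
    using P_term_nonzeroD[of n q i j k] that assms by force
  have "Sum_any (\<lambda>k. P_term n q i j k) = (\<Sum>k\<le>N. P_term n q i j k)" for i j
    using 0 by (intro Sum_any_atMost) auto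
  moreover have "Sum_any (\<lambda>j. \<Sum>k\<le>N. P_term n q i j k) = (\<Sum>j\<le>N. \<Sum>k\<le>N. P_term n q i j k)" for i
    using 0 by (intro Sum_any_atMost) auto
  moreover have "Sum_any (\<lambda>i. \<Sum>j\<le>N. \<Sum>k\<le>N. P_term n q i j k)
      = (\<Sum>i\<le>N. \<Sum>j\<le>N. \<Sum>k\<le>N. P_term n q i j k)"
    using 0 by (intro Sum_any_atMost) auto
  ultimately have "P n q = (\<Sum>i\<le>N. \<Sum>j\<le>N. \<Sum>k\<le>N. P_term n q i j k)"
    by (simp add: P_def)
  also have "\<dots> = (\<Sum>j\<le>N. \<Sum>i\<le>N. \<Sum>k\<le>N. P_term n q i j k)"
    by (rule sum.swap)
  finally show ?thesis
    by (simp only: term_fps_nth[OF assms])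
qed

definition P_fps :: "'a::field \<Rightarrow> 'a fps" where
  "P_fps q = Abs_fps (\<lambda>n. P n q)"

lemma P_fps_nth [simp]: "P_fps q $ n = P n q"
  by (simp add: P_fps_def)

text \<open>
  The equations for the individual terms telescope.  Only finitely many terms contribute to a given
  coefficient, so the sum over \<open>j\<close> is cut off at the index of the coefficient under comparison.
\<close>

lemma P_fps_equation:
  assumes "generic q"
  shows "(1 - fps_X) * (1 - fps_const q * fps_X\<^sup>2) * P_fps q
     = 1 + fps_const q * fps_X * (1 + fps_const q * fps_X\<^sup>2) * dilate q (P_fps q)"
proof -
  have P: "P_fps q $ m = (\<Sum>j\<le>N. term_fps q j) $ m" if "m \<le> N" for m N
    using P_eq_sum_term_fps[OF that, of q] by (simp add: fps_sum_nth)
  have cut: "(h * f) $ n = (h * g) $ n" if "\<And>m. m \<le> n \<Longrightarrow> f $ m = g $ m" for h f g :: "'a fps" and n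
    using that by (simp add: fps_mult_nth)
  show ?thesis
  proof (rule fps_ext)
    fix n
    let ?A = "(1 - fps_X) * (1 - fps_const q * fps_X\<^sup>2)"
    let ?B = "fps_const q * fps_X * (1 + fps_const q * fps_X\<^sup>2)"
    have "(?A * P_fps q) $ n = (?A * (\<Sum>j\<le>Suc n. term_fps q j)) $ n"
      by (rule cut) (rule P, simp)
    also have "?A * (\<Sum>j\<le>Suc n. term_fps q j) = ?A * term_fps q 0 + (\<Sum>j\<le>n. ?A * term_fps q (Suc j))"
      by (subst sum.atMost_Suc_shift) (simp only: distrib_left sum_distrib_left)
    also have "\<dots> = 1 + ?B * dilate q (\<Sum>j\<le>n. term_fps q j)"
      by (simp only: term_fps_0[OF assms] term_fps_Suc[OF assms] dilate_sum sum_distrib_left)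
    also have "\<dots> $ n = (1 + ?B * dilate q (P_fps q)) $ n"
      unfolding fps_add_nth by (intro arg_cong2[of _ _ _ _ "(+)"] refl cut) (simp add: P del: fps_sum_nth P_fps_nth)
    finally show "(?A * P_fps q) $ n = (1 + ?B * dilate q (P_fps q)) $ n" .
  qed
qed

lemma P_recurrence:
  assumes "generic q"
  shows "P 0 q = 1" "P 1 q = q + 1" "P 2 q = q ^ 3 + q ^ 2 + 2 * q + 1"
    and "P (n + 3) q = (1 + q ^ (n + 3)) * P (n + 2) q + q * P (n + 1) q + (q ^ (n + 2) - q) * P n q"
proof -
  have "P_fps q - fps_X * P_fps q - fps_const q * (fps_X ^ 2 * P_fps q) + fps_const q * (fps_X ^ 3 * P_fps q)
     = (1 - fps_X) * (1 - fps_const q * fps_X\<^sup>2) * P_fps q"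
    by (simp add: algebra_simps power2_eq_square power3_eq_cube)
  also have "\<dots> = 1 + fps_const q * (fps_X * dilate q (P_fps q))
      + fps_const q * (fps_const q * (fps_X ^ 3 * dilate q (P_fps q)))"
    unfolding P_fps_equation[OF assms]
    by (simp add: algebra_simps power2_eq_square power3_eq_cube del: fps_const_mult)
  finally have eq: "P_fps q - fps_X * P_fps q - fps_const q * (fps_X ^ 2 * P_fps q)
      + fps_const q * (fps_X ^ 3 * P_fps q)
      = 1 + fps_const q * (fps_X * dilate q (P_fps q))
      + fps_const q * (fps_const q * (fps_X ^ 3 * dilate q (P_fps q)))" .
  have coeff: "P m q - (if m = 0 then 0 else P (m - 1) q) - q * (if m < 2 then 0 else P (m - 2) q)
      + q * (if m < 3 then 0 else P (m - 3) q)
      = (if m = 0 then 1 else 0) + q * (if m = 0 then 0 else q ^ (m - 1) * P (m - 1) q)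
      + q * (q * (if m < 3 then 0 else q ^ (m - 3) * P (m - 3) q))" for m
    using arg_cong[OF eq, of "\<lambda>f. f $ m"]
    by (simp add: fps_X_power_mult_nth del: fps_const_mult cong: if_cong)
  show 0: "P 0 q = 1"
    using coeff[of 0] by simp
  show 1: "P 1 q = q + 1"
    using coeff[of 1] 0 by (simp add: algebra_simps)
  show "P 2 q = q ^ 3 + q ^ 2 + 2 * q + 1"
    using coeff[of 2] 0 1 by (simp add: algebra_simps power2_eq_square power3_eq_cube)
  show "P (n + 3) q = (1 + q ^ (n + 3)) * P (n + 2) q + q * P (n + 1) q + (q ^ (n + 2) - q) * P n q"
    using coeff[of "n + 3"] by (simp add: algebra_simps eval_nat_numeral)
qed

section \<open>Comparison of the two sides\<close>

lemma Fract_1_power: "Fract a 1 ^ n = Fract (a ^ n) (1 :: 'a::idom)"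
  by (induction n) (simp_all add: One_fract_def)

lemma generic_sqrt_q: "generic sqrt_q"
proof -
  have "sqrt_q ^ n \<noteq> 1" if "n > 0" for n
  proof
    assume "sqrt_q ^ n = 1"
    then have "[:0, 1 :: int:] ^ n = 1"
      by (simp add: sqrt_q_def Fract_1_power One_fract_def eq_fract)
    moreover have "degree ([:0, 1 :: int:] ^ n) = n"
      by (simp add: degree_power_eq)
    ultimately show False
      using that by simp
  qed
  moreover have "sqrt_q \<noteq> 0"
    by (simp add: sqrt_q_def Zero_fract_def eq_fract)
  ultimately show ?thesis
    by (simp add: generic_def)
qed

lemma theta_V_eq_bilateral_sum:
  "theta_V p n = Sum_any (\<lambda>j :: int. (- 1) powi j * (p\<^sup>2) powi (4 * j\<^sup>2 + j) * V (n + 1) (4 * j + 1) p)"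
proof -
  have "theta_weight p (4 * j + 1) = (p\<^sup>2) powi (4 * j\<^sup>2 + j)" for j
  proof -
    have "(4 * j + 1) * (4 * j + 1 - 1) = (2 * (4 * j\<^sup>2 + j)) * 2"
      by (simp add: power2_eq_square algebra_simps)
    then have "(4 * j + 1) * (4 * j + 1 - 1) div 2 = 2 * (4 * j\<^sup>2 + j)"
      by simp
    then have "theta_weight p (4 * j + 1) = p powi (2 * (4 * j\<^sup>2 + j))"
      by (simp only: theta_weight_def)
    also have "\<dots> = (p\<^sup>2) powi (4 * j\<^sup>2 + j)"
      by (simp only: power_int_mult power_int_numeral)
    finally show ?thesis .
  qed
  then show ?thesis
    by (simp add: theta_V_def theta_sum_def)
qed

lemma P_eq_theta_V:
  assumes "generic p"
  shows "P n (p\<^sup>2) = theta_V p n"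
proof (induction n rule: less_induct)
  case (less n)
  have g: "generic (p\<^sup>2)"
    using assms by (rule generic_power2)
  consider "n = 0" | "n = 1" | "n = 2" | m where "n = m + 3"
  proof -
    have "n = 0 \<or> n = 1 \<or> n = 2 \<or> n = (n - 3) + 3"
      by linarith
    then show ?thesis
      using that by blast
  qed
  then show ?case
  proof cases
    case 4
    then show ?thesis
      using less[of m] less[of "m + 1"] less[of "m + 2"]
      by (simp add: P_recurrence(4)[OF g] theta_V_recurrence[OF assms])
  qed (simp_all only: P_recurrence(1-3)[OF g] theta_V_012[OF assms])
qed

theorem mainTheorem13:
  "(\<forall>n. P n q_indet =
          Sum_any (\<lambda>j :: int. (- 1) powi j * q_indet powi (4 * j ^ 2 + j)
                               * V (n + 1) (4 * j + 1) sqrt_q))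
   \<and> P 0 q_indet = 1
   \<and> P 1 q_indet = q_indet + 1
   \<and> P 2 q_indet = q_indet ^ 3 + q_indet ^ 2 + 2 * q_indet + 1
   \<and> (\<forall>n\<ge>3. P n q_indet =
          (1 + q_indet ^ n) * P (n - 1) q_indet + q_indet * P (n - 2) q_indet
          + (q_indet ^ (n - 1) - q_indet) * P (n - 3) q_indet)"
proof (intro conjI allI impI)
  have g: "generic q_indet"
    unfolding q_indet_def by (rule generic_power2[OF generic_sqrt_q])
  show "P n q_indet = Sum_any (\<lambda>j :: int. (- 1) powi j * q_indet powi (4 * j ^ 2 + j)
                               * V (n + 1) (4 * j + 1) sqrt_q)" for n
    unfolding q_indet_def P_eq_theta_V[OF generic_sqrt_q] by (rule theta_V_eq_bilateral_sum)
  show "P 0 q_indet = 1" "P 1 q_indet = q_indet + 1"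
    "P 2 q_indet = q_indet ^ 3 + q_indet ^ 2 + 2 * q_indet + 1"
    by (rule P_recurrence[OF g])+
  fix n :: nat
  assume "n \<ge> 3"
  then have "n = (n - 3) + 3" "n - 1 = (n - 3) + 2" "n - 2 = (n - 3) + 1"
    by simp_all
  then show "P n q_indet =
          (1 + q_indet ^ n) * P (n - 1) q_indet + q_indet * P (n - 2) q_indet
          + (q_indet ^ (n - 1) - q_indet) * P (n - 3) q_indet"
    using P_recurrence(4)[OF g, of "n - 3"] by (simp only:)
qed

end
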